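(* Let $(X,d)$ be a complete metric space and let $\mathcal{A}=\{\mathcal{A}(t)\}_{t\in\mathbb{R}}$ be a selected pullback attractor of a generalized process in $X$ which is backward compact, i.e., $\overline{\bigcup_{s\le t}\mathcal{A}(s)}$ is a compact set for all $t\in\mathbb{R}$. Then $$\lim_{t\to-\infty}\mathrm{dist}(\mathcal{A}(t),\mathcal{A}(-\infty))=0,$$ where $\mathcal{A}(-\infty):=\bigcap_{t\in\mathbb{R}}\overline{\bigcup_{r\le t}\mathcal{A}(r)}$.
   Context: Let $(X,d)$ be a complete metric space. For nonempty $A,B\subset X$: $\mathrm{dist}(A,B)=\sup_{a\in A}\inf_{b\in B}d(a,b)$; for $\varepsilon>0$, $\mathcal{O}_\varepsilon(A)=\{z\in X:\inf_{a\in A}d(z,a)<\varepsilon\}$. Generalized process: a family $\mathscr{G}=\{\mathscr{G}(\tau)\}_{\tau\in\mathbb{R}}$ of sets $\mathscr{G}(\tau)$ consisting of functions $\varphi:[\tau,\infty)\to X$ (called solutions) such that: (C1) for each $\tau\in\mathbb{R}$ and $z\in X$ there is at least one $\varphi\in\mathscr{G}(\tau)$ with $\varphi(\tau)=z$; (C2) if $\varphi\in\mathscr{G}(\tau)$ and $s\ge 0$, then $\varphi|_{[\tau+s,\infty)}\in\mathscr{G}(\tau+s)$; (C3) if $\{\varphi_j\}_{j\in\mathbb{N}}\subset\mathscr{G}(\tau)$ and $\varphi_j(\tau)\to z$, then there are a subsequence $\{\varphi_{j_k}\}$ and $\varphi\in\mathscr{G}(\tau)$ with $\varphi(\tau)=z$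 and $\varphi_{j_k}(t)\to\varphi(t)$ as $k\to\infty$ for each $t\ge\tau$. A family $\mathcal{A}=\{\mathcal{A}(t)\}_{t\in\mathbb{R}}$ select pullback attracts $x\in X$ at time $t\in\mathbb{R}$ if for every $\varepsilon>0$ there is $\tau_0\le t$ such that for all $\tau\le\tau_0$ there is $\varphi_\tau\in\mathscr{G}(\tau)$ with $\varphi_\tau(\tau)=x$ and $\varphi_\tau(t)\in\mathcal{O}_\varepsilon(\mathcal{A}(t))$. A (global) selected pullback attractor of $\mathscr{G}$ is a family $\mathcal{A}=\{\mathcal{A}(t)\}_{t\in\mathbb{R}}$ of nonempty compact subsets of $X$ which select pullback attracts every $x\in X$ at every time $t\in\mathbb{R}$. *)

theory Defs
  imports "HOL-Analysis.Analysis"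
begin

(* Extended-real valued, so that the supremum is meaningful for unbounded A
   and the value is infinite (not a default number) for nonempty A and empty B. *)
definition hsemidist :: "'a::metric_space set \<Rightarrow> 'a set \<Rightarrow> ereal" where
  "hsemidist A B = (SUP a\<in>A. INF b\<in>B. ereal (dist a b))"

definition nbhd :: "real \<Rightarrow> 'a::metric_space set \<Rightarrow> 'a set" where
  "nbhd \<epsilon> A = {z. (INF a\<in>A. ereal (dist z a)) < ereal \<epsilon>}"

(* A function on [tau, infinity) is a total function that is extensional on {tau..}:
   it takes the dummy value "undefined" at times before tau. *)
definition generalized_process :: "(real \<Rightarrow> (real \<Rightarrow> 'a::metric_space) set) \<Rightarrow> bool" where
  "generalized_process G \<longleftrightarrow>
     (\<forall>\<tau>. G \<tau> \<subseteq> extensional {\<tau>..}) \<and>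
     (\<forall>\<tau> z. \<exists>\<phi>\<in>G \<tau>. \<phi> \<tau> = z) \<and>
     (\<forall>\<tau>. \<forall>\<phi>\<in>G \<tau>. \<forall>s\<ge>0. restrict \<phi> {\<tau> + s..} \<in> G (\<tau> + s)) \<and>
     (\<forall>\<tau> (\<phi> :: nat \<Rightarrow> real \<Rightarrow> 'a) z.
        (\<forall>j. \<phi> j \<in> G \<tau>) \<and> (\<lambda>j. \<phi> j \<tau>) \<longlonglongrightarrow> z \<longrightarrow>
        (\<exists>k \<psi>. strict_mono (k :: nat \<Rightarrow> nat) \<and> \<psi> \<in> G \<tau> \<and> \<psi> \<tau> = z \<and>
               (\<forall>t\<ge>\<tau>. (\<lambda>i. \<phi> (k i) t) \<longlonglongrightarrow> \<psi> t)))"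

definition select_pullback_attracts ::
  "(real \<Rightarrow> (real \<Rightarrow> 'a::metric_space) set) \<Rightarrow> (real \<Rightarrow> 'a set) \<Rightarrow> 'a \<Rightarrow> real \<Rightarrow> bool" where
  "select_pullback_attracts G A x t \<longleftrightarrow>
     (\<forall>\<epsilon>>0. \<exists>\<tau>\<^sub>0\<le>t. \<forall>\<tau>\<le>\<tau>\<^sub>0. \<exists>\<phi>\<in>G \<tau>. \<phi> \<tau> = x \<and> \<phi> t \<in> nbhd \<epsilon> (A t))"

definition selected_pullback_attractor ::
  "(real \<Rightarrow> (real \<Rightarrow> 'a::metric_space) set) \<Rightarrow> (real \<Rightarrow> 'a set) \<Rightarrow> bool" where
  "selected_pullback_attractor G A \<longleftrightarrow>
     (\<forall>t. A t \<noteq> {} \<and> compact (A t)) \<and> (\<forall>x t. select_pullback_attracts G A x t)"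

definition backward_compact :: "(real \<Rightarrow> 'a::metric_space set) \<Rightarrow> bool" where
  "backward_compact A \<longleftrightarrow> (\<forall>t. compact (closure (\<Union>s\<in>{..t}. A s)))"

definition limit_at_minus_infinity :: "(real \<Rightarrow> 'a::metric_space set) \<Rightarrow> 'a set" where
  "limit_at_minus_infinity A = (\<Inter>t. closure (\<Union>r\<in>{..t}. A r))"

end

theory Submission
  imports Defs
begin

text \<open>
  The sets \<open>closure (\<Union>s\<le>t. A s)\<close> are compact and shrink to \<open>A(-\<infinity>)\<close> as \<open>t\<close> decreases, so by
  compactness they eventually enter every open neighbourhood of it, and they contain \<open>A t\<close>.
\<close>

text \<open>Fix any \<open>a\<close>. A point of \<open>K a\<close> outside \<open>U\<close> misses
  some \<open>K t\<close>, so the open sets \<open>U \<union> - K t\<close> cover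
  \<open>K a\<close>, and compactness leaves finitely many indices \<open>C\<close>.\<close>

lemma compact_decreasing_eventually_subset_open:
  fixes K :: "'i::linorder \<Rightarrow> 'a::t2_space set"
  assumes compact: "\<And>t. compact (K t)"
    and mono: "\<And>s t. s \<le> t \<Longrightarrow> K s \<subseteq> K t"
    and "open U" and "(\<Inter>t. K t) \<subseteq> U"
  shows "\<exists>t0. \<forall>t\<le>t0. K t \<subseteq> U"
proof -
  fix a :: 'i
  have "open (U \<union> - K t)" for t
    using \<open>open U\<close> compact by (intro open_Un open_Compl compact_imp_closed)
  moreover have "K a \<subseteq> (\<Union>t. U \<union> - K t)"
    using \<open>(\<Inter>t. K t) \<subseteq> U\<close> by auto
  ultimately obtain C where "finite C" and C: "K a \<subseteq> (\<Union>t\<in>C. U \<union> - K t)"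
    by (meson compactE_image[OF compact])
  show ?thesis
  \<comment> \<open>Inserting \<open>a\<close> keeps the minimum meaningful when \<open>C\<close> is
    empty and gives \<open>K t \<subseteq> K a\<close>, so the finite cover applies. A point of
    \<open>K t\<close> lies in every \<open>K c\<close> with \<open>c \<in> C\<close>, which leaves
    only \<open>U\<close>.\<close>
  proof (intro exI[of _ "Min (insert a C)"] allI impI)
    fix t
    assume "t \<le> Min (insert a C)"
    with \<open>finite C\<close> have "t \<le> a" "\<And>c. c \<in> C \<Longrightarrow> t \<le> c"
      by auto
    with mono C show "K t \<subseteq> U"
      by blast
  qed
qed

lemma hsemidist_nonneg:
  assumes "A \<noteq> {}"
  shows "0 \<le> hsemidist A B"
proof -
  \<comment> \<open>A point is required: in \<open>ereal\<close> the supremum over the empty set is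
    \<open>-\<infinity>\<close>.\<close>
  obtain a where "a \<in> A"
    using assms by blast
  have "0 \<le> (INF b\<in>B. ereal (dist a b))"
    by (rule INF_greatest) simp
  also have "\<dots> \<le> hsemidist A B"
    unfolding hsemidist_def using \<open>a \<in> A\<close> by (rule SUP_upper)
  finally show ?thesis .
qed

lemma hsemidist_le:
  assumes "A \<subseteq> (\<Union>b\<in>B. ball b e)"
  shows "hsemidist A B \<le> ereal e"
  unfolding hsemidist_def
proof (rule SUP_least)
  fix a
  assume "a \<in> A"
  then obtain b where "b \<in> B" "dist a b < e"
    using assms by (auto simp: dist_commute)
  then show "(INF b\<in>B. ereal (dist a b)) \<le> ereal e"
    by (intro INF_lower2[of b]) auto
qed

theorem theorem13:
  fixes G :: "real \<Rightarrow> (real \<Rightarrow> 'a::complete_space) set"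
    and A :: "real \<Rightarrow> 'a set"
  assumes "generalized_process G"
    and "selected_pullback_attractor G A"
    and "backward_compact A"
  shows "((\<lambda>t. hsemidist (A t) (limit_at_minus_infinity A)) \<longlongrightarrow> 0) at_bot"
proof (rule order_tendstoI)
  have nonneg: "0 \<le> hsemidist (A t) (limit_at_minus_infinity A)" for t
    using assms(2) by (intro hsemidist_nonneg) (simp add: selected_pullback_attractor_def)
  fix c :: ereal
  {
    assume "c < 0"
    with nonneg show "\<forall>\<^sub>F t in at_bot. c < hsemidist (A t) (limit_at_minus_infinity A)"
      by (intro always_eventually allI) (rule less_le_trans)
  }
  assume "0 < c"
  \<comment> \<open>Balls need a real radius, while \<open>c\<close> may be infinite. Since
    \<open>hsemidist_le\<close> bounds a supremum and so is not strict, the gap between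
    \<open>e\<close> and \<open>c\<close> restores strictness.\<close>
  then obtain e where e: "0 < ereal e" "ereal e < c"
    using ereal_dense2 by blast
  define K where "K t = closure (\<Union>s\<in>{..t}. A s)" for t
  define U where "U = (\<Union>b\<in>limit_at_minus_infinity A. ball b e)"
  have "compact (K t)" for t
    using assms(3) by (simp add: backward_compact_def K_def)
  moreover have "K s \<subseteq> K t" if "s \<le> t" for s t
    unfolding K_def using that by (intro closure_mono UN_mono) auto
  moreover have "open U"
    by (auto simp: U_def)
  \<comment> \<open>The intersection is the limit set itself, and each of its points is the centre
    of one of the balls.\<close>
  moreover have "(\<Inter>t. K t) \<subseteq> U"
    using e(1) by (force simp: U_def K_def limit_at_minus_infinity_def)
  ultimately obtain t0 where t0: "\<And>t. t \<le> t0 \<Longrightarrow> K t \<subseteq> U"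
    using compact_decreasing_eventually_subset_open[of K U] by blast
  have "A t \<subseteq> K t" for t
    unfolding K_def by (rule order_trans[OF _ closure_subset]) auto
  with t0 have "hsemidist (A t) (limit_at_minus_infinity A) \<le> ereal e" if "t \<le> t0" for t
    using that unfolding U_def by (intro hsemidist_le) blast
  with e(2) show "\<forall>\<^sub>F t in at_bot. hsemidist (A t) (limit_at_minus_infinity A) < c"
    unfolding eventually_at_bot_linorder by (meson le_less_trans)
qed

end
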